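(* If $X$ is a countable, second countable topological space, then $\mathcal{M}(X)$, as a subset of $\mathcal{P}(X)$, is not $\boldsymbol{\Sigma}^0_1$-complete, not $\boldsymbol{\Delta}^0_2$-sharp, and not $\boldsymbol{\Pi}^0_2$-complete.
   Context: "Countable" means countably infinite (the paper writes "at most countable" when finite sets are allowed). For a topological space $X$, a subset $A\subseteq X$ is dense in an open set $U$ if $U\subseteq\overline{A}$, and codense in $U$ if $U\subseteq\overline{X\setminus A}$. A subset $A\subseteq X$ is monitorable if for every non-empty open set $U\subseteq X$ either $A$ is not dense in $U$ or $A$ is not codense in $U$. $\mathcal{M}(X)\subseteq\mathcal{P}(X)$ denotes the family of monitorable subsets of $X$. The powerset $\mathcal{P}(X)$ is identified with $2^X$ via characteristic functions and carries the product topology (with $2=\{0,1\}$ discrete); for countable $X$ it is homeomorphic to the Cantor space. $\boldsymbol{\Sigma}^0_\alpha,\boldsymbol{\Pi}^0_\alpha$ are the usual classes of the Borel hierarchy ($\boldsymbol{\Sigma}^0_1$ = open sets, $\boldsymbol{\Pi}^0_\alpha$ = complements of $\boldsymbol{\Sigma}^0_\alpha$ sets, $\boldsymbol{\Sigma}^0_\alpha$ = at most countable unions of sets in $\bigcup_{\beta<\alpha}\boldsymbol{\Pi}^0_\beta$ for $\alpha\geq 2$), and $\boldsymbol{\Delta}^0_\alpha=\boldsymbol{\Sigma}^0_\alpha\cap\boldsymbol{\Pi}^0_\alpha$. For a boldface pointclass $\boldsymbol{\Gamma}$ and a Polish space $Z$, a set $A\subseteq Z$ is $\boldsymbol{\Gamma}$-hard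 if for every zero-dimensional Polish space $Y$ and every $B\in\boldsymbol{\Gamma}(Y)$ there is a continuous $f:Y\to Z$ with $B=f^{-1}(A)$; $A$ is $\boldsymbol{\Gamma}$-complete if $A\in\boldsymbol{\Gamma}(Z)$ and $A$ is $\boldsymbol{\Gamma}$-hard. For $\alpha\ge2$, $A\subseteq Z$ is $\boldsymbol{\Delta}^0_\alpha$-sharp if $A\in\boldsymbol{\Delta}^0_\alpha(Z)\setminus\bigcup_{\beta<\alpha}(\boldsymbol{\Sigma}^0_\beta(Z)\cup\boldsymbol{\Pi}^0_\beta(Z))$. *)

theory Defs
  imports "HOL-Analysis.Analysis"
begin

definition dense_in :: "'a topology \<Rightarrow> 'a set \<Rightarrow> 'a set \<Rightarrow> bool" where
  "dense_in X A U \<longleftrightarrow> U \<subseteq> X closure_of A"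

definition codense_in :: "'a topology \<Rightarrow> 'a set \<Rightarrow> 'a set \<Rightarrow> bool" where
  "codense_in X A U \<longleftrightarrow> U \<subseteq> X closure_of (topspace X - A)"

definition monitorable :: "'a topology \<Rightarrow> 'a set \<Rightarrow> bool" where
  "monitorable X A \<longleftrightarrow> A \<subseteq> topspace X \<and>
     (\<forall>U. openin X U \<and> U \<noteq> {} \<longrightarrow> \<not> dense_in X A U \<or> \<not> codense_in X A U)"

definition monitorable_sets :: "'a topology \<Rightarrow> 'a set set" where
  "monitorable_sets X = {A. monitorable X A}"

definition char_fun :: "'a set \<Rightarrow> 'a set \<Rightarrow> 'a \<Rightarrow> bool" where
  "char_fun S A = (\<lambda>x\<in>S. x \<in> A)"

text \<open>On \<^term>\<open>Pow S\<close> the map \<^term>\<open>char_fun S\<close> is a bijection onto the carrier of the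
  product topology below, see \<open>homeomorphic_map_char_fun\<close>.\<close>

definition powerset_topology :: "'a set \<Rightarrow> 'a set topology" where
  "powerset_topology S =
     pullback_topology (Pow S) (char_fun S)
       (product_topology (\<lambda>_. discrete_topology (UNIV :: bool set)) S)"

text \<open>Additive Borel classes of finite level, with levels starting at 1; the class of level 0 is
  a dummy.\<close>

fun borel_sigma :: "nat \<Rightarrow> 'a topology \<Rightarrow> 'a set set" where
  "borel_sigma 0 X = {}"
| "borel_sigma (Suc 0) X = {U. openin X U}"
| "borel_sigma (Suc (Suc n)) X =
     {\<Union>\<U> | \<U>. countable \<U> \<and>
        \<U> \<subseteq> (\<Union>m\<in>{1..<Suc (Suc n)}. (\<lambda>S. topspace X - S) ` borel_sigma m X)}"

definition borel_pi :: "nat \<Rightarrow> 'a topology \<Rightarrow> 'a set set" where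
  "borel_pi n X = (\<lambda>S. topspace X - S) ` borel_sigma n X"

definition borel_delta :: "nat \<Rightarrow> 'a topology \<Rightarrow> 'a set set" where
  "borel_delta n X = borel_sigma n X \<inter> borel_pi n X"

text \<open>A boldface pointclass assigns a family of sets to spaces over different types, so it cannot
  be passed around as a function; we pass around names of pointclasses instead.\<close>

datatype pointclass = Sigma0 nat | Pi0 nat | Delta0 nat

fun sets_of :: "pointclass \<Rightarrow> 'a topology \<Rightarrow> 'a set set" where
  "sets_of (Sigma0 n) X = borel_sigma n X"
| "sets_of (Pi0 n) X = borel_pi n X"
| "sets_of (Delta0 n) X = borel_delta n X"

definition polish_topology :: "'a topology \<Rightarrow> bool" where
  "polish_topology X \<longleftrightarrow> completely_metrizable_space X \<and> second_countable X"

text \<open>Zero-dimensional spaces are those with a base of clopen sets; the library expresses this as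
  \<^prop>\<open>Y dim_le 0\<close>, cf. \<open>dimension_le_0_neighbourhood_base_of_clopen\<close>.

  The test spaces \<open>Y\<close> range over all topologies whose carrier is a set of elements of type
  \<^typ>\<open>nat set\<close>. Up to homeomorphism these are all Polish spaces, so hardness yields
  reductions for Polish spaces over any type: see \<open>hard_reduction\<close>.\<close>

definition hard :: "pointclass \<Rightarrow> 'a topology \<Rightarrow> 'a set \<Rightarrow> bool" where
  "hard \<Gamma> Z A \<longleftrightarrow>
     (\<forall>(Y :: nat set topology) B.
        polish_topology Y \<and> Y dim_le 0 \<and> B \<in> sets_of \<Gamma> Y \<longrightarrow>
        (\<exists>f. continuous_map Y Z f \<and> B = {y \<in> topspace Y. f y \<in> A}))"

definition complete_for :: "pointclass \<Rightarrow> 'a topology \<Rightarrow> 'a set \<Rightarrow> bool" where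
  "complete_for \<Gamma> Z A \<longleftrightarrow> A \<in> sets_of \<Gamma> Z \<and> hard \<Gamma> Z A"

definition delta_sharp :: "nat \<Rightarrow> 'a topology \<Rightarrow> 'a set \<Rightarrow> bool" where
  "delta_sharp n Z A \<longleftrightarrow>
     A \<in> borel_delta n Z - (\<Union>m\<in>{1..<n}. borel_sigma m Z \<union> borel_pi m Z)"


lemma topspace_powerset_topology [simp]: "topspace (powerset_topology S) = Pow S"
  by (auto simp: powerset_topology_def topspace_pullback_topology char_fun_def)

lemma homeomorphic_map_char_fun:
  "homeomorphic_map (powerset_topology S)
     (product_topology (\<lambda>_. discrete_topology (UNIV :: bool set)) S) (char_fun S)"
    (is "homeomorphic_map ?P ?T _")
proof (rule bijective_open_imp_homeomorphic_map)
  have inj: "inj_on (char_fun S) (Pow S)"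
    by (auto simp: inj_on_def char_fun_def fun_eq_iff restrict_def split: if_splits)
  then show "inj_on (char_fun S) (topspace ?P)"
    by simp
  have img: "char_fun S ` Pow S = topspace ?T"
  proof
    show "char_fun S ` Pow S \<subseteq> topspace ?T"
      by (auto simp: char_fun_def)
    show "topspace ?T \<subseteq> char_fun S ` Pow S"
    proof
      fix g assume "g \<in> topspace ?T"
      then have "g = char_fun S {x \<in> S. g x}"
        by (auto simp: char_fun_def restrict_def PiE_def extensional_def fun_eq_iff)
      then show "g \<in> char_fun S ` Pow S"
        by blast
    qed
  qed
  then show "char_fun S ` topspace ?P = topspace ?T"
    by simp
  show "continuous_map ?P ?T (char_fun S)"
    using continuous_map_pullback[OF continuous_map_id, of "Pow S" "char_fun S" ?T]
    by (simp add: powerset_topology_def o_def id_def)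
  show "open_map ?P ?T (char_fun S)"
    unfolding open_map_def
  proof (intro allI impI)
    fix W assume "openin ?P W"
    then obtain U where U: "openin ?T U" "W = char_fun S -` U \<inter> Pow S"
      by (auto simp: powerset_topology_def openin_pullback_topology)
    have "char_fun S ` W = U"
    proof
      show "char_fun S ` W \<subseteq> U"
        using U(2) by blast
      show "U \<subseteq> char_fun S ` W"
      proof
        fix g assume "g \<in> U"
        then have "g \<in> char_fun S ` Pow S"
          unfolding img using openin_subset[OF U(1)] by (rule rev_subsetD)
        then obtain A where A: "A \<in> Pow S" "g = char_fun S A"
          by (rule imageE)
        then have "A \<in> W"
          using \<open>g \<in> U\<close> unfolding U(2) by simp
        then show "g \<in> char_fun S ` W"
          unfolding A(2) by (rule imageI)
      qed
    qed
    then show "openin ?T (char_fun S ` W)"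
      using U by simp
  qed
qed

lemma borel_sigma_ge_2:
  "2 \<le> n \<Longrightarrow> borel_sigma n X = {\<Union>\<U> | \<U>. countable \<U> \<and> \<U> \<subseteq> (\<Union>m\<in>{1..<n}. borel_pi m X)}"
  by (cases "(n, X)" rule: borel_sigma.cases) (simp_all add: borel_pi_def)

lemma borel_sigma_subset: "S \<in> borel_sigma n X \<Longrightarrow> S \<subseteq> topspace X"
  by (cases "(n, X)" rule: borel_sigma.cases) (auto dest: openin_subset)

lemma borel_sigma_homeomorphic:
  assumes "homeomorphic_map X Y h"
  shows "S \<in> borel_sigma n X \<Longrightarrow> h ` S \<in> borel_sigma n Y"
proof (induction n arbitrary: S rule: less_induct)
  case (less n)
  have inj: "inj_on h (topspace X)" and surj: "h ` topspace X = topspace Y"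
    using assms by (simp_all add: homeomorphic_eq_everything_map)
  consider "n = 0" | "n = 1" | "2 \<le> n"
    by linarith
  then show ?case
  proof cases
    case 1
    then show ?thesis using less.prems by simp
  next
    case 2
    then show ?thesis
      using less.prems homeomorphic_map_openness_eq[OF assms] by simp
  next
    case 3
    then obtain \<U> where \<U>: "S = \<Union>\<U>" "countable \<U>" "\<U> \<subseteq> (\<Union>m\<in>{1..<n}. borel_pi m X)"
      using less.prems by (auto simp: borel_sigma_ge_2)
    have "(`) h ` \<U> \<subseteq> (\<Union>m\<in>{1..<n}. borel_pi m Y)"
    proof
      fix W assume "W \<in> (`) h ` \<U>"
      then obtain T where T: "T \<in> \<U>" "W = h ` T"
        by (rule imageE)
      then obtain m where m1: "m \<in> {1..<n}" "T \<in> borel_pi m X"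
        using \<U>(3) by (meson UN_E subsetD)
      then obtain V where V: "V \<in> borel_sigma m X" "T = topspace X - V"
        by (auto simp: borel_pi_def)
      have m: "m \<in> {1..<n}" "V \<in> borel_sigma m X" "W = h ` (topspace X - V)"
        using T m1 V by simp_all
      have "W = topspace Y - h ` V"
        unfolding m(3) surj[symmetric]
        using inj borel_sigma_subset[OF m(2)] by (intro inj_on_image_set_diff) auto
      then show "W \<in> (\<Union>m\<in>{1..<n}. borel_pi m Y)"
        using m(1) less.IH[OF _ m(2)] by (auto simp: borel_pi_def)
    qed
    moreover have "h ` S = \<Union>((`) h ` \<U>)"
      unfolding \<U>(1) by (rule image_Union)
    moreover have "countable ((`) h ` \<U>)"
      using \<U>(2) by (rule countable_image)
    ultimately show ?thesis
      unfolding borel_sigma_ge_2[OF 3] by blast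
  qed
qed

lemma borel_pi_homeomorphic:
  assumes h: "homeomorphic_map X Y h" and S: "S \<in> borel_pi n X"
  shows "h ` S \<in> borel_pi n Y"
proof -
  have inj: "inj_on h (topspace X)" and surj: "h ` topspace X = topspace Y"
    using h by (simp_all add: homeomorphic_eq_everything_map)
  obtain V where V: "V \<in> borel_sigma n X" "S = topspace X - V"
    using S by (auto simp: borel_pi_def)
  have "h ` S = topspace Y - h ` V"
    unfolding V(2) surj[symmetric]
    using inj borel_sigma_subset[OF V(1)] by (intro inj_on_image_set_diff) auto
  then show ?thesis
    using borel_sigma_homeomorphic[OF h V(1)] by (auto simp: borel_pi_def)
qed

lemma sets_of_subset: "S \<in> sets_of \<Gamma> X \<Longrightarrow> S \<subseteq> topspace X"
  by (cases \<Gamma>) (auto simp: borel_pi_def borel_delta_def dest: borel_sigma_subset)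

lemma sets_of_homeomorphic:
  "\<lbrakk>homeomorphic_map X Y h; S \<in> sets_of \<Gamma> X\<rbrakk> \<Longrightarrow> h ` S \<in> sets_of \<Gamma> Y"
  by (cases \<Gamma>) (auto simp: borel_delta_def borel_sigma_homeomorphic borel_pi_homeomorphic)

lemma polish_topology_embeds_nat_set:
  fixes Y :: "'b topology"
  assumes "polish_topology Y"
  obtains Y' :: "nat set topology" and e where "homeomorphic_map Y Y' e"
proof -
  have "second_countable Y"
    using assms by (simp add: polish_topology_def)
  then obtain \<B> where \<B>: "countable \<B>" "\<And>V. V \<in> \<B> \<Longrightarrow> openin Y V"
    "\<And>U x. openin Y U \<Longrightarrow> x \<in> U \<Longrightarrow> \<exists>V\<in>\<B>. x \<in> V \<and> V \<subseteq> U"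
    unfolding second_countable_def by metis
  have "t0_space Y"
    using assms
    by (simp add: polish_topology_def completely_metrizable_imp_metrizable_space
        metrizable_imp_t1_space t1_imp_t0_space)
  define e where "e x = to_nat_on \<B> ` {V \<in> \<B>. x \<in> V}" for x
  have inj: "inj_on e (topspace Y)"
  proof (rule inj_onI, rule ccontr)
    fix x y assume xy: "x \<in> topspace Y" "y \<in> topspace Y" "e x = e y" "x \<noteq> y"
    then obtain U where U: "openin Y U" "x \<notin> U \<longleftrightarrow> y \<in> U"
      using \<open>t0_space Y\<close> unfolding t0_space_def by metis
    have same: "{V \<in> \<B>. x \<in> V} = {V \<in> \<B>. y \<in> V}"
      using xy(3) inj_on_to_nat_on[OF \<B>(1)] unfolding e_def
      by (subst (asm) inj_on_image_eq_iff[where C = \<B>]) auto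
    show False
    proof (cases "x \<in> U")
      case True
      then obtain V where "V \<in> \<B>" "x \<in> V" "V \<subseteq> U"
        using \<B>(3)[OF U(1)] by blast
      then show False using same U(2) True by blast
    next
      case False
      then obtain V where "V \<in> \<B>" "y \<in> V" "V \<subseteq> U"
        using \<B>(3)[OF U(1)] U(2) by blast
      then show False using same False by blast
    qed
  qed
  define g where "g = inv_into (topspace Y) e"
  define Y' where "Y' = pullback_topology (e ` topspace Y) g Y"
  have ge: "g (e x) = x" if "x \<in> topspace Y" for x
    using inj that by (simp add: g_def)
  have top: "topspace Y' = e ` topspace Y"
    by (auto simp: Y'_def topspace_pullback_topology ge)
  have "homeomorphic_map Y Y' e"
  proof (rule bijective_open_imp_homeomorphic_map)
    show "continuous_map Y Y' e"
      unfolding Y'_def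
    proof (rule continuous_map_pullback')
      show "continuous_map Y Y (g \<circ> e)"
        by (rule continuous_map_eq[OF continuous_map_id]) (simp add: ge)
    qed auto
    show "open_map Y Y' e"
      unfolding open_map_def
    proof (intro allI impI)
      fix U assume "openin Y U"
      moreover from this have "e ` U = g -` U \<inter> e ` topspace Y"
        using openin_subset[of Y U] by (force simp: ge)
      ultimately show "openin Y' (e ` U)"
        unfolding Y'_def openin_pullback_topology by blast
    qed
  qed (simp_all add: top inj)
  then show ?thesis
    by (rule that)
qed

lemma homeomorphic_zero_dimensional:
  assumes h: "homeomorphic_map X Y h" and X: "X dim_le 0"
  shows "Y dim_le 0"
  using h homeomorphic_map_imp_homeomorphic_space X homeomorphic_space_dimension_le by blast

lemma hard_reduction:
  fixes Y :: "'b topology"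
  assumes "hard \<Gamma> Z A" "polish_topology Y" "Y dim_le 0" "B \<in> sets_of \<Gamma> Y"
  obtains f where "continuous_map Y Z f" "B = {y \<in> topspace Y. f y \<in> A}"
proof -
  obtain Y' :: "nat set topology" and e where e: "homeomorphic_map Y Y' e"
    using polish_topology_embeds_nat_set[OF assms(2)] by blast
  then have hom: "Y homeomorphic_space Y'"
    by (rule homeomorphic_map_imp_homeomorphic_space)
  have "polish_topology Y'"
    using assms(2) homeomorphic_completely_metrizable_space[OF hom]
      homeomorphic_space_second_countability[OF hom] by (simp add: polish_topology_def)
  moreover have "Y' dim_le 0"
    using homeomorphic_zero_dimensional[OF e assms(3)] .
  moreover have "e ` B \<in> sets_of \<Gamma> Y'"
    using sets_of_homeomorphic[OF e assms(4)] .
  ultimately obtain f where f: "continuous_map Y' Z f" "e ` B = {y \<in> topspace Y'. f y \<in> A}"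
    using assms(1) unfolding hard_def by blast
  have inj: "inj_on e (topspace Y)" and surj: "e ` topspace Y = topspace Y'"
    and cont: "continuous_map Y Y' e"
    using e by (simp_all add: homeomorphic_eq_everything_map)
  have "y \<in> B \<longleftrightarrow> f (e y) \<in> A" if "y \<in> topspace Y" for y
    using inj_on_image_mem_iff[OF inj that sets_of_subset[OF assms(4)]] f(2) surj that by auto
  then have "B = {y \<in> topspace Y. (f \<circ> e) y \<in> A}"
    using sets_of_subset[OF assms(4)] by auto
  then show ?thesis
    using that continuous_map_compose[OF cont f(1)] by blast
qed

end

(* The monitorable sets are closed under symmetric difference, so they form a subgroup of the compact
   group P(X), which is (Z/2)^X.  A subgroup H of a compact group that is a countable intersection of
   open sets is closed: H is comeagre in its closure K, and for x in K - H the coset x + H would be a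
   second comeagre subset of K, disjoint from H, against the Baire category theorem.  Hence M(X) is
   closed as soon as it is Pi^0_2, and a closed set is neither Delta^0_2-sharp nor hard for a
   pointclass containing all open sets, because a zero-dimensional Polish space can have open sets
   that are not closed. *)

theory Submission
  imports Defs
begin

section \<open>Monitorable sets under symmetric difference\<close>

text \<open>If \<open>U\<close> does not lie in the closure of \<open>B\<close>, then
  \<open>U\<close> minus this closure is a nonempty open set missing \<open>B\<close>. Taking
  \<open>A\<close> and its complement for \<open>B\<close> gives a local form: membership in
  \<open>A\<close> is constant on some nonempty open part of \<open>U\<close>.\<close>

lemma monitorable_iff:
  "monitorable X A \<longleftrightarrow> A \<subseteq> topspace X \<and>
     (\<forall>U. openin X U \<and> U \<noteq> {} \<longrightarrow>
       (\<exists>V. openin X V \<and> V \<noteq> {} \<and> V \<subseteq> U \<and> (V \<subseteq> A \<or> V \<inter> A = {})))"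
proof -
  have not_dense: "\<not> U \<subseteq> X closure_of B \<longleftrightarrow> (\<exists>V. openin X V \<and> V \<noteq> {} \<and> V \<subseteq> U \<and> V \<inter> B = {})"
    if U: "openin X U" for U B
  proof
    assume "\<not> U \<subseteq> X closure_of B"
    moreover have "U \<inter> B \<subseteq> X closure_of B"
      using openin_subset[OF U] closure_of_subset_Int[of X B] by blast
    ultimately have "U - X closure_of B \<noteq> {}" "(U - X closure_of B) \<inter> B = {}"
      by auto
    then show "\<exists>V. openin X V \<and> V \<noteq> {} \<and> V \<subseteq> U \<and> V \<inter> B = {}"
      using openin_diff[OF U closedin_closure_of] by blast
  next
    assume "\<exists>V. openin X V \<and> V \<noteq> {} \<and> V \<subseteq> U \<and> V \<inter> B = {}"
    then show "\<not> U \<subseteq> X closure_of B"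
      by (metis inf.absorb_iff1 openin_Int_closure_of_eq_empty order.trans)
  qed
  have "V \<subseteq> A \<longleftrightarrow> V \<inter> (topspace X - A) = {}" if "openin X V" for V
    using openin_subset[OF that] by blast
  then show ?thesis
    unfolding monitorable_def dense_in_def codense_in_def by (metis not_dense)
qed

text \<open>Shrinking twice gives a nonempty open set on which membership in \<open>A\<close> and in
  \<open>B\<close> is constant, hence also membership in \<open>sym_diff A B\<close>.\<close>

lemma monitorable_sym_diff:
  assumes A: "monitorable X A" and B: "monitorable X B"
  shows "monitorable X (sym_diff A B)"
  unfolding monitorable_iff
proof (intro conjI allI impI)
  show "sym_diff A B \<subseteq> topspace X"
    using A B by (auto simp: monitorable_def)
  fix U assume "openin X U \<and> U \<noteq> {}"
  then obtain V where V: "openin X V" "V \<noteq> {}" "V \<subseteq> U" "V \<subseteq> A \<or> V \<inter> A = {}"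
    using A unfolding monitorable_iff by meson
  then obtain W where W: "openin X W" "W \<noteq> {}" "W \<subseteq> V" "W \<subseteq> B \<or> W \<inter> B = {}"
    using B unfolding monitorable_iff by meson
  have "W \<subseteq> sym_diff A B \<or> W \<inter> sym_diff A B = {}"
    using V(4) W(3,4) by blast
  then show "\<exists>V. openin X V \<and> V \<noteq> {} \<and> V \<subseteq> U \<and> (V \<subseteq> sym_diff A B \<or> V \<inter> sym_diff A B = {})"
    using V W by blast
qed

section \<open>Translations and compactness of the power set\<close>

text \<open>Continuity is checked by coordinates: at \<open>k\<close> the map acts on the two-point
  space as negation if \<open>k \<in> C\<close> and as the identity otherwise.\<close>

lemma continuous_map_sym_diff:
  assumes "C \<subseteq> S"
  shows "continuous_map (powerset_topology S) (powerset_topology S) (sym_diff C)"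
proof -
  let ?P = "powerset_topology S" and ?D = "discrete_topology (UNIV :: bool set)"
  have proj: "continuous_map ?P ?D (\<lambda>A. char_fun S A k)" if "k \<in> S" for k
    using homeomorphic_imp_continuous_map[OF homeomorphic_map_char_fun[of S]] that
    by (auto simp: continuous_map_componentwise)
  have "continuous_map ?P ?D (\<lambda>A. char_fun S (sym_diff C A) k)" if k: "k \<in> S" for k
  proof -
    have "continuous_map ?P ?D ((\<lambda>b. b \<noteq> (k \<in> C)) \<circ> (\<lambda>A. char_fun S A k))"
      by (rule continuous_map_compose[OF proj[OF k]]) simp
    then show ?thesis
      by (rule continuous_map_eq) (auto simp: char_fun_def k)
  qed
  then have "continuous_map ?P (product_topology (\<lambda>_. ?D) S) (char_fun S \<circ> sym_diff C)"
    by (auto simp: continuous_map_componentwise char_fun_def)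
  then have "continuous_map ?P
      (pullback_topology (Pow S) (char_fun S) (product_topology (\<lambda>_. ?D) S)) (sym_diff C)"
    by (rule continuous_map_pullback') (use assms in auto)
  then show ?thesis
    by (simp only: powerset_topology_def)
qed

lemma powerset_topology_compact_Hausdorff:
  "compact_space (powerset_topology S)" "Hausdorff_space (powerset_topology S)"
proof -
  let ?T = "product_topology (\<lambda>_. discrete_topology (UNIV :: bool set)) S"
  have hom: "powerset_topology S homeomorphic_space ?T"
    using homeomorphic_map_char_fun by (rule homeomorphic_map_imp_homeomorphic_space)
  have "compact_space ?T"
    by (simp add: compact_space_product_topology compact_space_discrete_topology)
  then show "compact_space (powerset_topology S)"
    using homeomorphic_compact_space[OF hom] by simp
  have "Hausdorff_space ?T"
    by (simp add: Hausdorff_space_product_topology)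
  then show "Hausdorff_space (powerset_topology S)"
    using homeomorphic_Hausdorff_space[OF hom] by simp
qed

section \<open>Baire category in the closure of a subgroup\<close>

lemma closedin_powerset_topology_if_sym_diff_closed:
  assumes Pi2: "H \<in> borel_pi 2 (powerset_topology S)"
    and sym: "\<And>A B. A \<in> H \<Longrightarrow> B \<in> H \<Longrightarrow> sym_diff A B \<in> H"
  shows "closedin (powerset_topology S) H"
proof -
  let ?P = "powerset_topology S"
  define K where "K = ?P closure_of H"
  let ?K = "subtopology ?P K"
  obtain \<F> where \<F>: "countable \<F>" "\<F> \<subseteq> borel_pi 1 ?P" "H = Pow S - \<Union>\<F>"
    using Pi2 by (auto simp: borel_pi_def borel_sigma_ge_2 numeral_2_eq_2)
  have closed_F: "closedin ?P F" if "F \<in> \<F>" for F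
  proof -
    obtain U where "openin ?P U" "F = topspace ?P - U"
      using subsetD[OF \<F>(2) \<open>F \<in> \<F>\<close>] by (auto simp: borel_pi_def)
    then show ?thesis
      by (metis closedin_diff closedin_topspace)
  qed
  have K: "closedin ?P K" "K \<subseteq> Pow S" "H \<subseteq> K"
    unfolding K_def using \<F>(3) closedin_subset[of ?P K]
    by (auto simp: closure_of_subset) (metis PowD closure_of_subset_topspace subsetD topspace_powerset_topology)
  have topK: "topspace ?K = K"
    using K(2) by auto
  have cancel: "sym_diff C (sym_diff C A) = A" for A C :: "'a set"
    by blast
  \<comment> \<open>Continuity sends the closure of \<open>H\<close> into the closure of its image,
    which lies in the closed set \<open>K\<close>.\<close>
  have closure_translate: "sym_diff C A \<in> K"
    if C: "C \<subseteq> S" and H: "\<And>B. B \<in> H \<Longrightarrow> sym_diff C B \<in> K" and A: "A \<in> K" for A C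
  proof -
    have "sym_diff C ` H \<subseteq> K"
      using H by auto
    then have "?P closure_of (sym_diff C ` H) \<subseteq> K"
      using K(1) by (rule closure_of_minimal)
    then show ?thesis
      using continuous_map_image_closure_subset[OF continuous_map_sym_diff[OF C], of H] A
      unfolding K_def by auto
  qed
  \<comment> \<open>Closure under sums passes from \<open>H\<close> to \<open>K\<close> one argument
    at a time: translation by an element of \<open>H\<close> maps \<open>H\<close>, hence
    \<open>K\<close>, into \<open>K\<close>; so translation by \<open>A \<in> K\<close> maps
    \<open>H\<close>, and then \<open>K\<close>, into \<open>K\<close>.\<close>
  have add: "sym_diff A B \<in> K" if A: "A \<in> K" and B: "B \<in> K" for A B
  proof (rule closure_translate[OF _ _ B])
    show "A \<subseteq> S"
      using A K(2) by auto
    fix C assume C: "C \<in> H"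
    have "sym_diff C A \<in> K"
      using C K A by (intro closure_translate[OF _ _ A]) (auto intro: subsetD[OF K(3) sym])
    then show "sym_diff A C \<in> K"
      by (simp add: Un_commute)
  qed
  have "K \<subseteq> H"
  proof (rule ccontr)
    assume "\<not> K \<subseteq> H"
    then obtain x where x: "x \<in> K" "x \<notin> H"
      by auto
    have hom: "homeomorphic_map ?K ?K (sym_diff x)"
    proof -
      have "continuous_map ?K ?K (sym_diff x)"
        using continuous_map_sym_diff[of x S] x(1) K(2) add[OF x(1)]
        by (auto simp: continuous_map_in_subtopology intro: continuous_map_from_subtopology)
      then have "homeomorphic_maps ?K ?K (sym_diff x) (sym_diff x)"
        by (auto simp: homeomorphic_maps_def cancel)
      then show ?thesis
        by (rule homeomorphic_maps_map[THEN iffD1, THEN conjunct1])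
    qed
    define \<G> where "\<G> = (\<lambda>F. F \<inter> K) ` \<F>"
    have G: "closedin ?K G \<and> ?K interior_of G = {}" if "G \<in> \<G>" for G
    proof
      obtain F where F: "F \<in> \<F>" "G = F \<inter> K"
        using \<open>G \<in> \<G>\<close> unfolding \<G>_def by (rule imageE)
      show "closedin ?K G"
        unfolding F(2) closedin_closed_subtopology[OF K(1)]
        by (intro conjI closedin_Int closed_F F(1) K(1) Int_lower2)
      \<comment> \<open>\<open>H\<close> is dense in \<open>K\<close>, so an open subset of
        \<open>G\<close>, which misses \<open>H\<close>, must be empty.\<close>
      have "?K closure_of H = topspace ?K"
        unfolding topK using K(3) by (simp add: closure_of_subtopology K_def[symmetric] Int_absorb1)
      moreover have "?K interior_of G \<inter> H = {}"
        using F \<F>(3) interior_of_subset[of ?K G] by blast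
      ultimately show "?K interior_of G = {}"
        using openin_interior_of[of ?K G] by (metis Int_commute dense_intersects_open)
    qed
    have G': "closedin ?K G \<and> ?K interior_of G = {}" if "G \<in> (`) (sym_diff x) ` \<G>" for G
    proof -
      obtain E where E: "E \<in> \<G>" "G = sym_diff x ` E"
        using \<open>G \<in> (`) (sym_diff x) ` \<G>\<close> by (rule imageE)
      then have sub: "E \<subseteq> topspace ?K"
        using G closedin_subset by blast
      show ?thesis
        unfolding E(2) homeomorphic_map_interior_of[OF hom sub]
          homeomorphic_map_closedness[OF hom sub]
        using G[OF E(1)] by simp
    qed
    \<comment> \<open>\<open>\<G>\<close> covers \<open>K - H\<close>, and its translates cover
      \<open>H\<close>: for \<open>A \<in> H\<close> the set \<open>sym_diff x A\<close> lies in
      \<open>K - H\<close>, since otherwise \<open>x\<close>, its sum with \<open>A\<close>, would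
      lie in \<open>H\<close>.\<close>
    have cover: "\<Union>(\<G> \<union> (`) (sym_diff x) ` \<G>) = K"
    proof
      show "\<Union>(\<G> \<union> (`) (sym_diff x) ` \<G>) \<subseteq> K"
      proof (rule Union_least)
        fix E assume "E \<in> \<G> \<union> (`) (sym_diff x) ` \<G>"
        then have "closedin ?K E"
          using G G' by blast
        then show "E \<subseteq> K"
          using closedin_subset topK by metis
      qed
      show "K \<subseteq> \<Union>(\<G> \<union> (`) (sym_diff x) ` \<G>)"
      proof
        fix A assume A: "A \<in> K"
        have K_H: "B \<in> \<Union>\<G>" if "B \<in> K" "B \<notin> H" for B
          using that \<F>(3) K(2) by (auto simp: \<G>_def)
        show "A \<in> \<Union>(\<G> \<union> (`) (sym_diff x) ` \<G>)"
        proof (cases "A \<in> H")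
          case True
          have "sym_diff x A \<notin> H"
          proof
            assume "sym_diff x A \<in> H"
            from sym[OF True this] have "sym_diff A (sym_diff x A) \<in> H" .
            moreover have "sym_diff A (sym_diff x A) = x"
              by blast
            ultimately show False
              using x(2) by simp
          qed
          then have "sym_diff x A \<in> \<Union>\<G>"
            using K_H add[OF x(1) A] by blast
          then obtain G where G: "G \<in> \<G>" "sym_diff x A \<in> G"
            by blast
          have "A \<in> sym_diff x ` G"
            using G(2) by (rule image_eqI[where f = "sym_diff x", OF cancel[of x A, symmetric]])
          then show ?thesis
            using \<open>G \<in> \<G>\<close> by blast
        next
          case False
          then show ?thesis
            using K_H A by blast
        qed
      qed
    qed
    have "?K interior_of \<Union>(\<G> \<union> (`) (sym_diff x) ` \<G>) = {}"
    proof (rule Baire_category_alt)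
      have "compact_space ?K" "Hausdorff_space ?K"
        using K(1) powerset_topology_compact_Hausdorff[of S]
        by (auto simp: closedin_compact_space compact_space_subtopology Hausdorff_space_subtopology)
      then show "completely_metrizable_space ?K \<or> locally_compact_space ?K \<and> regular_space ?K"
        by (simp add: compact_imp_locally_compact_space compact_Hausdorff_imp_regular_space)
      show "countable (\<G> \<union> (`) (sym_diff x) ` \<G>)"
        using \<F>(1) by (simp add: \<G>_def)
    qed (use G G' in blast)
    \<comment> \<open>\<open>K\<close> is open in itself, so it equals the interior just shown to be
      empty.\<close>
    then have "K = {}"
      unfolding cover by (metis interior_of_topspace topK)
    then show False
      using x(1) by simp
  qed
  then show ?thesis
    using K by simp
qed

section \<open>Closed sets and hardness\<close>

text \<open>A nondegenerate open interval is uncountable, so it has points outside \<open>S\<close>.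
  When both end points avoid \<open>S\<close>, the open and the closed interval have the same trace
  on \<open>S\<close>, which is therefore clopen.\<close>

lemma countable_real_zero_dimensional:
  fixes S :: "real set"
  assumes "countable S"
  shows "top_of_set S dim_le 0"
  unfolding dimension_le_0_neighbourhood_base_of_clopen
proof (subst open_neighbourhood_base_of)
  have gap: "\<exists>c. a < c \<and> c < b \<and> c \<notin> S" if "a < b" for a b :: real
    using uncountable_open_interval[of a b] that countable_subset[OF _ assms, of "{a<..<b}"]
    by (auto simp: subset_iff)
  show "\<forall>V a. openin (top_of_set S) V \<and> a \<in> V \<longrightarrow>
      (\<exists>U. (closedin (top_of_set S) U \<and> openin (top_of_set S) U) \<and> a \<in> U \<and> U \<subseteq> V)"
  proof (intro allI impI)
    fix V a assume "openin (top_of_set S) V \<and> a \<in> V"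
    then obtain e where e: "e > 0" "a \<in> V" "V \<subseteq> S" "ball a e \<inter> S \<subseteq> V"
      by (auto simp: openin_contains_ball)
    obtain c d where cd: "a - e < c" "c < a" "c \<notin> S" "a < d" "d < a + e" "d \<notin> S"
      using gap[of "a - e" a] gap[of a "a + e"] e(1) by auto
    define U where "U = S \<inter> {c<..<d}"
    have "U = S \<inter> {c..d}"
      using cd by (auto simp: U_def less_le)
    then have "closedin (top_of_set S) U"
      by (simp add: closedin_closed_Int)
    moreover have "openin (top_of_set S) U"
      by (simp add: U_def openin_open_Int)
    moreover have "a \<in> U" "U \<subseteq> V"
      using e cd by (auto simp: U_def dist_real_def subset_iff abs_less_iff)
    ultimately show "\<exists>U. (closedin (top_of_set S) U \<and> openin (top_of_set S) U) \<and> a \<in> U \<and> U \<subseteq> V"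
      by blast
  qed
qed blast

lemma second_countable_euclidean:
  "second_countable (euclidean :: 'a::second_countable_topology topology)"
proof -
  obtain \<B> :: "'a set set" where \<B>: "countable \<B>" "topological_basis \<B>"
    using ex_countable_basis by blast
  then show ?thesis
    unfolding second_countable_def
    by (metis open_openin topological_basisE topological_basis_open)
qed

text \<open>The test space is a convergent sequence together with its limit. Removing the limit
  leaves an open set that is not closed, whereas a reduction to \<open>A\<close> would make it the
  preimage of a closed set.\<close>

lemma closedin_not_hard:
  assumes closed: "closedin Z A"
    and opens: "\<And>(Y :: real topology) U. openin Y U \<Longrightarrow> U \<in> sets_of \<Gamma> Y"
  shows "\<not> hard \<Gamma> Z A"
proof
  assume hard: "hard \<Gamma> Z A"
  \<comment> \<open>\<open>Suc n\<close> keeps every term nonzero: with \<open>real n\<close> the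
    first term would be \<open>inverse 0 = 0\<close>, the limit itself.\<close>
  define s where "s n = inverse (real (Suc n))" for n
  define S where "S = insert 0 (range s)"
  let ?Y = "top_of_set S"
  have lim: "s \<longlonglongrightarrow> 0"
    unfolding s_def by (rule LIMSEQ_inverse_real_of_nat)
  have "closed S"
    unfolding S_def by (intro compact_imp_closed compact_sequence_with_limit lim)
  then have "polish_topology ?Y"
    by (simp add: polish_topology_def completely_metrizable_space_closedin
        completely_metrizable_space_euclidean second_countable_euclidean second_countable_subtopology)
  moreover have "?Y dim_le 0"
    by (rule countable_real_zero_dimensional) (simp add: S_def)
  moreover have "openin ?Y (S - {0})"
    by (simp add: Diff_eq openin_open_Int open_Compl)
  ultimately obtain f where f: "continuous_map ?Y Z f" "S - {0} = {y \<in> topspace ?Y. f y \<in> A}"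
    using hard_reduction[OF hard _ _ opens] by metis
  then have "closedin ?Y (S - {0})"
    using closedin_continuous_map_preimage[OF f(1) closed] by simp
  then have "closed (S - {0})"
    using \<open>closed S\<close> closedin_closed_trans by blast
  moreover have "s n \<in> S - {0}" for n
    by (simp add: S_def s_def)
  ultimately have "0 \<in> S - {0}"
    using lim closed_sequentially by blast
  then show False
    by simp
qed

section \<open>Low Borel classes and the three conclusions\<close>

text \<open>The complement is closed and is the union of the family consisting of it alone. This
  serves twice: it brings an open \<open>?M\<close> within reach of the closedness result, and it
  supplies the open test sets for \<open>Pi0 2\<close>.\<close>

lemma open_in_borel_pi_2: "openin X U \<Longrightarrow> U \<in> borel_pi 2 X"
proof -
  assume U: "openin X U"
  then have "topspace X - U \<in> borel_pi 1 X"
    by (auto simp: borel_pi_def)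
  then have "topspace X - U \<in> borel_sigma 2 X"
    unfolding borel_sigma_ge_2[OF order_refl]
    by (intro CollectI exI[of _ "{topspace X - U}"]) auto
  moreover have "U = topspace X - (topspace X - U)"
    using openin_subset[OF U] by blast
  ultimately show ?thesis
    unfolding borel_pi_def by blast
qed

theorem corollary3p8:
  fixes X :: "'a topology"
  assumes "countable (topspace X)" and "infinite (topspace X)"
    and "second_countable X"
  shows "\<not> complete_for (Sigma0 1) (powerset_topology (topspace X)) (monitorable_sets X)
    \<and> \<not> delta_sharp 2 (powerset_topology (topspace X)) (monitorable_sets X)
    \<and> \<not> complete_for (Pi0 2) (powerset_topology (topspace X)) (monitorable_sets X)"
proof -
  let ?P = "powerset_topology (topspace X)" and ?M = "monitorable_sets X"
  have closed: "closedin ?P ?M" if "?M \<in> borel_pi 2 ?P"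
    using that by (rule closedin_powerset_topology_if_sym_diff_closed)
      (simp add: monitorable_sets_def monitorable_sym_diff)
  \<comment> \<open>Completeness would make \<open>?M\<close> open, hence \<open>Pi0 2\<close>,
    hence closed, and a closed set is not hard for a class containing the open sets.\<close>
  have "\<not> complete_for (Sigma0 1) ?P ?M"
    using closed closedin_not_hard[of ?P ?M "Sigma0 1"] open_in_borel_pi_2[of ?P ?M]
    by (auto simp: complete_for_def)
  moreover have "\<not> complete_for (Pi0 2) ?P ?M"
    using closed closedin_not_hard[of ?P ?M "Pi0 2"] open_in_borel_pi_2
    by (auto simp: complete_for_def)
  moreover have "\<not> delta_sharp 2 ?P ?M"
  proof
    assume sharp: "delta_sharp 2 ?P ?M"
    then have M: "closedin ?P ?M"
      by (intro closed) (simp add: delta_sharp_def borel_delta_def)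
    then have "?M = topspace ?P - (topspace ?P - ?M)" "openin ?P (topspace ?P - ?M)"
      using closedin_subset by blast+
    \<comment> \<open>Being closed is membership in a class of level 1, which sharpness at level 2
      excludes.\<close>
    then have "?M \<in> borel_pi 1 ?P"
      unfolding borel_pi_def by auto
    then show False
      using sharp by (simp add: delta_sharp_def)
  qed
  ultimately show ?thesis
    by blast
qed

end
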